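(* Let $(X,d)$ be an arbitrary metric space. Then $(X,d^{1/2})$ satisfies the Ptolemy inequality.
   Context: Here $d^{1/2}(x,x')=\sqrt{d(x,x')}$. A metric space $(Y,\rho)$ satisfies the Ptolemy inequality if for all $y_1,y_2,y_3,y_4\in Y$ $$\rho(y_1,y_3)\rho(y_2,y_4)\le\rho(y_1,y_2)\rho(y_3,y_4)+\rho(y_2,y_3)\rho(y_4,y_1).$$ *)

theory Defs
  imports "HOL-Analysis.Analysis"
begin

locale Ptolemy_metric_space = Metric_space +
  assumes ptolemy:
    "\<lbrakk>y1 \<in> M; y2 \<in> M; y3 \<in> M; y4 \<in> M\<rbrakk> \<Longrightarrow>
      d y1 y3 * d y2 y4 \<le> d y1 y2 * d y3 y4 + d y2 y3 * d y4 y1"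

end

theory Submission
  imports Defs
begin

text \<open>Label the sides of a quadrilateral cyclically \<open>a, b, c, e\<close>. Its diagonals satisfy
  \<open>p \<le> min (a + b) (c + e)\<close> and \<open>q \<le> min (b + c) (a + e)\<close>. Up to a rotation both minima are
  attained at the sums containing \<open>c\<close>, and then
  \<open>pq \<le> (c + e) (b + c) = be + ac + c (b + c + e - a)\<close>, where \<open>c \<le> sqrt (ac)\<close> and
  \<open>b + c + e - a \<le> 2 min b e \<le> 2 sqrt (be)\<close>. Hence \<open>pq \<le> (sqrt (ac) + sqrt (be))\<^sup>2\<close>.\<close>

lemma sqrt_ptolemy_of_sums_ordered:
  fixes a b c e p q :: real
  assumes nonneg: "0 \<le> a" "0 \<le> b" "0 \<le> c" "0 \<le> e" "0 \<le> q"
    and diag: "p \<le> c + e" "q \<le> b + c"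
    and sums: "c + e \<le> a + b" "b + c \<le> a + e"
  shows "sqrt p * sqrt q \<le> sqrt a * sqrt c + sqrt b * sqrt e"
proof -
  have "min b e \<le> sqrt (b * e)"
    using nonneg by (intro real_le_rsqrt) (auto simp: power2_eq_square intro!: mult_mono)
  \<comment> \<open>The two inequalities in \<open>sums\<close> bound the left side by
    \<open>2 * b\<close> and \<open>2 * e\<close> respectively.\<close>
  then have be: "b + c + e - a \<le> 2 * sqrt (b * e)"
    using sums by linarith
  \<comment> \<open>Adding the two inequalities in \<open>sums\<close> gives c \<le> a.\<close>
  have ac: "c \<le> sqrt (a * c)"
    using nonneg sums by (intro real_le_rsqrt) (auto simp: power2_eq_square intro!: mult_right_mono)
  have "p * q \<le> (c + e) * (b + c)"
    using nonneg diag by (intro mult_mono) auto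
  also have "\<dots> = a * c + b * e + c * (b + c + e - a)"
    by (simp add: algebra_simps)
  also have "c * (b + c + e - a) \<le> c * (2 * sqrt (b * e))"
    using be nonneg by (intro mult_left_mono)
  also have "\<dots> \<le> sqrt (a * c) * (2 * sqrt (b * e))"
    using ac nonneg by (intro mult_right_mono) auto
  also have "a * c + b * e + sqrt (a * c) * (2 * sqrt (b * e)) = (sqrt (a * c) + sqrt (b * e))\<^sup>2"
    using nonneg by (simp add: power2_sum)
  finally have "sqrt (p * q) \<le> sqrt (a * c) + sqrt (b * e)"
    using nonneg by (intro real_le_lsqrt) auto
  then show ?thesis
    by (simp add: real_sqrt_mult)
qed

text \<open>The smaller sum for each diagonal leaves four cases; the side shared by the two smaller
  sums fixes the rotation. A rotation by one step swaps \<open>p\<close> and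
  \<open>q\<close>.\<close>

lemma sqrt_ptolemy:
  fixes a b c e p q :: real
  assumes nonneg: "0 \<le> a" "0 \<le> b" "0 \<le> c" "0 \<le> e" "0 \<le> p" "0 \<le> q"
    and "p \<le> a + b" "p \<le> c + e" "q \<le> b + c" "q \<le> a + e"
  shows "sqrt p * sqrt q \<le> sqrt a * sqrt c + sqrt b * sqrt e"
  using sqrt_ptolemy_of_sums_ordered[of a b c e q p]
    sqrt_ptolemy_of_sums_ordered[of b c e a p q]
    sqrt_ptolemy_of_sums_ordered[of c e a b q p]
    sqrt_ptolemy_of_sums_ordered[of e a b c p q] assms
  by (smt (verit) mult.commute)

context Metric_space
begin

lemma Metric_space_sqrt: "Metric_space M (\<lambda>x y. sqrt (d x y))"
proof
  fix x y z assume "x \<in> M" "y \<in> M" "z \<in> M"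
  then have "sqrt (d x z) \<le> sqrt (d x y + d y z)"
    by (simp add: triangle)
  also have "\<dots> \<le> sqrt (d x y) + sqrt (d y z)"
    by (simp add: sqrt_add_le_add_sqrt)
  finally show "sqrt (d x z) \<le> sqrt (d x y) + sqrt (d y z)" .
qed (auto simp: commute)

lemma Ptolemy_metric_space_sqrt: "Ptolemy_metric_space M (\<lambda>x y. sqrt (d x y))"
proof (intro Ptolemy_metric_space.intro Ptolemy_metric_space_axioms.intro Metric_space_sqrt)
  fix w x y z assume "w \<in> M" "x \<in> M" "y \<in> M" "z \<in> M"
  then show "sqrt (d w y) * sqrt (d x z)
      \<le> sqrt (d w x) * sqrt (d y z) + sqrt (d x y) * sqrt (d z w)"
    \<comment> \<open>Each diagonal is a side of two triangles, one through each remaining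
      vertex.\<close>
    using triangle[of w x y] triangle[of w z y] triangle[of x y z] triangle[of x w z]
    by (intro sqrt_ptolemy) (auto simp: commute)
qed

end

theorem proposition1p8:
  fixes X :: "'a set" and d :: "'a \<Rightarrow> 'a \<Rightarrow> real"
  assumes "Metric_space X d"
  shows "Ptolemy_metric_space X (\<lambda>x x'. sqrt (d x x'))"
  using assms by (rule Metric_space.Ptolemy_metric_space_sqrt)

end
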